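(* Let $q$ be a prime power, let $n$ be a positive integer, let $s$ be an integer with $\gcd(s,2n)=1$, and let $\gamma\in\mathbb F_{q^{2n}}$ be such that $N(\gamma)$ is a non-square in $\mathbb F_q$. Let $k$ be an integer satisfying $1\le k\le 2n-1$. Then the right nucleus of $\mathcal D_{k,s}(\gamma)$ is $$\mathcal N_r(\mathcal D_{k,s}(\gamma))=\{aX: a\in\mathbb F_{q^n}\},$$ and its middle nucleus is $$\mathcal N_m(\mathcal D_{k,s}(\gamma))=\{aX: a\in\mathbb F_{q^n}\}.$$
   Context: $N=N_{q^{2n}/q}$ denotes the norm from $\mathbb F_{q^{2n}}$ to $\mathbb F_q$. A $q$-polynomial over $\mathbb F_{q^{2n}}$ is a polynomial $\sum_i c_iX^{q^i}$ with $c_i\in\mathbb F_{q^{2n}}$; $q$-polynomials are considered modulo $X^{q^{2n}}-X$ (so the exponent $i$ in $X^{q^i}$ is read modulo $2n$) and are identified with $\mathbb F_q$-linear maps of $\mathbb F_{q^{2n}}$, i.e. with matrices in $\mathbb F_q^{2n\times 2n}$. Define $$\mathcal D_{k,s}(\gamma)=\Big\{aX+\sum_{i=1}^{k-1}c_iX^{q^{is}}+\gamma bX^{q^{ks}} : c_1,\dots,c_{k-1}\in\mathbb F_{q^{2n}},\ a,b\in\mathbb F_{q^n}\Big\}.$$ For a set $\mathcal C$ of $q$-polynomials over $\mathbb F_{q^{2n}}$, the middle nucleus is $\mathcal N_m(\mathcal C)=\{\varphi : f\circ\varphi\in\mathcal C\text{ for all }f\in\mathcal C\}$ and the right nucleus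 is $\mathcal N_r(\mathcal C)=\{\varphi : \varphi\circ f\in\mathcal C\text{ for all }f\in\mathcal C\}$, where $\varphi$ ranges over $q$-polynomials over $\mathbb F_{q^{2n}}$ and $\circ$ is composition (modulo $X^{q^{2n}}-X$).
   Formalization: The case n = 1 is excluded: there k = 1 and D_{1,s}(γ) is closed under composition, since γX^q∘γX^q = N(γ)X, so both nuclei contain γX^q and the claim as printed is false. *)

theory Defs
  imports
    "HOL-Computational_Algebra.Computational_Algebra"
    "HOL-Number_Theory.Prime_Powers"
begin

text \<open>
  Throughout, the ambient type is a finite field with \<open>q ^ (2 * n)\<close> elements; this assumption is
  made in the theorems, the definitions take \<open>q\<close> and \<open>n\<close> as parameters.
\<close>

text \<open>
  The subfield with \<open>q ^ m\<close> elements, as the fixed points of the Frobenius power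
  (its order is checked in \<open>card_subfield_of_order\<close> below).
\<close>
definition subfield_of_order :: "nat \<Rightarrow> nat \<Rightarrow> 'a::finite_field set" where
  "subfield_of_order q m = {x. x ^ (q ^ m) = x}"

text \<open>The norm from the field with \<open>q ^ (2 * n)\<close> elements to the field with \<open>q\<close> elements.\<close>
definition norm_to_base :: "nat \<Rightarrow> nat \<Rightarrow> 'a::finite_field \<Rightarrow> 'a" where
  "norm_to_base q n x = (\<Prod>i<2 * n. x ^ (q ^ i))"

definition is_square_in :: "'a::finite_field set \<Rightarrow> 'a \<Rightarrow> bool" where
  "is_square_in K x \<longleftrightarrow> (\<exists>y\<in>K. x = y ^ 2)"

definition q_modulus :: "nat \<Rightarrow> nat \<Rightarrow> 'a::finite_field poly" where
  "q_modulus q n = monom 1 (q ^ (2 * n)) - monom 1 1"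

text \<open>
  A residue class of \<open>q\<close>-polynomials modulo \<open>q_modulus q n\<close> is represented by its reduced member,
  that is, the one involving only the exponents \<open>q ^ i\<close> with \<open>i < 2 * n\<close>.
\<close>
definition q_polys :: "nat \<Rightarrow> nat \<Rightarrow> 'a::finite_field poly set" where
  "q_polys q n = {\<Sum>i<2 * n. monom (c i) (q ^ i) | c. True}"

text \<open>The term \<open>c X^(q^j)\<close> with the integer \<open>j\<close> read modulo \<open>2 * n\<close>.\<close>
definition q_monom :: "nat \<Rightarrow> nat \<Rightarrow> 'a::finite_field \<Rightarrow> int \<Rightarrow> 'a poly" where
  "q_monom q n c j = monom c (q ^ nat (j mod int (2 * n)))"

definition q_comp :: "nat \<Rightarrow> nat \<Rightarrow> 'a::finite_field poly \<Rightarrow> 'a poly \<Rightarrow> 'a poly" where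
  "q_comp q n f g = pcompose f g mod q_modulus q n"

definition D_set :: "nat \<Rightarrow> nat \<Rightarrow> nat \<Rightarrow> int \<Rightarrow> 'a::finite_field \<Rightarrow> 'a poly set" where
  "D_set q n k s \<gamma> =
     {q_monom q n a 0 + (\<Sum>i=1..k-1. q_monom q n (c i) (int i * s))
        + q_monom q n (\<gamma> * b) (int k * s) | a b c.
        a \<in> subfield_of_order q n \<and> b \<in> subfield_of_order q n}"

definition middle_nucleus :: "nat \<Rightarrow> nat \<Rightarrow> 'a::finite_field poly set \<Rightarrow> 'a poly set" where
  "middle_nucleus q n C = {\<phi> \<in> q_polys q n. \<forall>f\<in>C. q_comp q n f \<phi> \<in> C}"

definition right_nucleus :: "nat \<Rightarrow> nat \<Rightarrow> 'a::finite_field poly set \<Rightarrow> 'a poly set" where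
  "right_nucleus q n C = {\<phi> \<in> q_polys q n. \<forall>f\<in>C. q_comp q n \<phi> f \<in> C}"

lemma card_subfield_of_order:
  fixes q m n :: nat
  assumes card: "card (UNIV :: 'a::finite_field set) = q ^ n" and dvd: "m dvd n" and pos: "0 < m"
    and q: "1 < q"
  shows "card (subfield_of_order q m :: 'a set) = q ^ m"
proof -
  obtain r where r: "n = m * r" using dvd by blast
  have n0: "0 < n"
  proof (rule ccontr)
    assume "\<not> 0 < n"
    then have "card (UNIV :: 'a set) = 1" using card by simp
    then show False by (metis card_1_singletonE UNIV_I singletonD zero_neq_one)
  qed
  define Q where "Q = q ^ m"
  define N where "N = q ^ n"
  have Q1: "1 < Q" and N1: "1 < N" using q pos n0 unfolding Q_def N_def by (blast intro: one_less_power)+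
  have NQ: "N = Q ^ r" by (simp add: N_def Q_def r power_mult)
  have "Q - 1 dvd N - 1"
  proof -
    have "int Q - 1 dvd int Q ^ r - 1"
      by (metis dvd_triv_left power_diff_1_eq)
    then have "int (Q - 1) dvd int (N - 1)" using Q1 N1 NQ by (simp add: of_nat_diff)
    then show ?thesis by presburger
  qed
  then obtain t where t: "N - 1 = (Q - 1) * t" by blast
  let ?g = "monom 1 Q - monom 1 1 :: 'a poly"
  let ?G = "monom 1 N - monom 1 1 :: 'a poly"
  have fac: "?g dvd ?G"
  proof -
    let ?y = "monom 1 (Q - 1) :: 'a poly"
    have g: "?g = monom 1 1 * (?y - 1)"
      using Q1 by (simp add: algebra_simps mult_monom)
    have G: "?G = monom 1 1 * (?y ^ t - 1)"
    proof -
      have "?y ^ t = monom 1 (N - 1)" unfolding t by (simp add: monom_power)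
      then show ?thesis using N1 by (simp add: right_diff_distrib mult_monom)
    qed
    have "?y - 1 dvd ?y ^ t - 1" by (metis dvd_triv_left power_diff_1_eq)
    then show ?thesis unfolding g G by (rule mult_dvd_mono[OF dvd_refl])
  qed
  then obtain h where h: "?G = ?g * h" by blast
  have degg: "degree ?g = Q" "?g \<noteq> 0"
  proof -
    show "degree ?g = Q" using Q1 by (subst diff_conv_add_uminus, subst degree_add_eq_left) (auto simp: degree_monom_eq)
    then show "?g \<noteq> 0" using Q1 by (metis degree_0 not_one_less_zero)
  qed
  have degG: "degree ?G = N" "?G \<noteq> 0"
  proof -
    show "degree ?G = N" using N1 by (subst diff_conv_add_uminus, subst degree_add_eq_left) (auto simp: degree_monom_eq)
    then show "?G \<noteq> 0" using N1 by (metis degree_0 not_one_less_zero)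
  qed
  have h0: "h \<noteq> 0" using h degG(2) by auto
  have degh: "Q + degree h = N" using h degg degG h0 by (metis degree_mult_eq)
  have S: "subfield_of_order q m = {x::'a. poly ?g x = 0}"
    by (auto simp: subfield_of_order_def Q_def poly_monom)
  have "UNIV = {x::'a. poly ?G x = 0}"
    using finite_field_power_card_eq_same[where 'a='a] card by (auto simp: N_def poly_monom)
  also have "\<dots> = {x. poly ?g x = 0} \<union> {x. poly h x = 0}" unfolding h by auto
  finally have "N \<le> card {x::'a. poly ?g x = 0} + card {x. poly h x = 0}"
    using card_Un_le card N_def by metis
  moreover have "card {x. poly h x = 0} \<le> degree h" by (rule card_poly_roots_bound[OF h0])
  moreover have "card {x::'a. poly ?g x = 0} \<le> Q" using card_poly_roots_bound[OF degg(2)] degg by simp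
  ultimately show ?thesis using degh S Q_def by simp
qed

text \<open>
  For \<open>n = 1\<close> (hence \<open>k = 1\<close>) the set \<open>D_set q 1 1 s \<gamma>\<close> is closed under composition and
  is a field of order \<open>q ^ 2\<close>. In particular its middle nucleus contains \<open>\<gamma> X^q\<close>, so it is not
  \<open>{a X | a. a \<in> subfield_of_order q 1}\<close>.
\<close>
lemma middle_nucleus_degenerate:
  fixes q :: nat and s :: int and \<gamma> :: "'a::finite_field"
  assumes card: "card (UNIV :: 'a set) = q ^ 2" and q: "primepow q" and s: "gcd s 2 = 1"
    and nonsq: "\<not> is_square_in (subfield_of_order q 1) (norm_to_base q 1 \<gamma>)"
  shows "middle_nucleus q 1 (D_set q 1 1 s \<gamma>) \<noteq> {monom a 1 | a. a \<in> subfield_of_order q 1}"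
proof -
  have q1: "1 < q" using primepow_gt_Suc_0[OF q] by simp
  have "odd s" using s by (metis gcd.commute gcd_dvd1 gcd_dvd2 odd_one dvd_refl gcd_greatest)
  then have sm: "nat (s mod 2) = 1" by (simp add: odd_iff_mod_2_eq_one)
  have frob: "x ^ (q * q) = x" for x :: 'a
    using finite_field_power_card_eq_same[of x] card by (simp add: power2_eq_square)
  have N: "norm_to_base q (Suc 0) \<gamma> = \<gamma> * \<gamma> ^ q"
    by (simp add: norm_to_base_def numeral_2_eq_2)
  have \<gamma>0: "\<gamma> \<noteq> 0"
  proof
    assume "\<gamma> = 0"
    then have "norm_to_base q 1 \<gamma> = 0 ^ 2" using N by simp
    moreover have "(0::'a) \<in> subfield_of_order q 1" using q1 by (simp add: subfield_of_order_def)
    ultimately show False using nonsq unfolding is_square_in_def by blast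
  qed
  have D: "D_set q 1 1 s \<gamma> = {monom a 1 + monom (\<gamma> * b) q | a b. a ^ q = a \<and> b ^ q = b}"
    by (auto simp: D_set_def q_monom_def sm subfield_of_order_def)
  let ?\<phi> = "monom \<gamma> q"
  have "?\<phi> = (\<Sum>i<2 * 1. monom (if i = 1 then \<gamma> else 0) (q ^ i))"
    by (simp add: numeral_2_eq_2)
  then have qp: "?\<phi> \<in> q_polys q 1" unfolding q_polys_def by (intro CollectI exI conjI TrueI)
  have "q_comp q 1 f ?\<phi> \<in> D_set q 1 1 s \<gamma>" if f: "f \<in> D_set q 1 1 s \<gamma>" for f
  proof -
    obtain a b where ab: "f = monom a 1 + monom (\<gamma> * b) q" "a ^ q = a" "b ^ q = b"
      using f D by auto
    let ?c = "b * (\<gamma> * \<gamma> ^ q)"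
    let ?r = "monom ?c 1 + monom (\<gamma> * a) q"
    have pm: "pcompose (monom u j) g = smult u (g ^ j)" for u j and g :: "'a poly"
    proof -
      have "pcompose (monom 1 j) g = g ^ j"
        by (induction j) (simp_all add: monom_Suc pcompose_pCons pcompose_1)
      then show ?thesis by (metis mult.right_neutral pcompose_smult smult_monom)
    qed
    have "pcompose f ?\<phi> = ?r + smult ?c (q_modulus q 1)"
      by (simp add: ab pcompose_add pm monom_power q_modulus_def smult_monom smult_diff_right
          power2_eq_square algebra_simps)
    moreover have "degree ?r < degree (q_modulus q 1 :: 'a poly)"
    proof -
      have qq: "q < q ^ 2" using q1 by (simp add: power2_eq_square)
      have "degree ?r \<le> q"
        using q1 by (intro degree_add_le order.trans[OF degree_monom_le]) auto
      moreover have "degree (q_modulus q 1 :: 'a poly) = q ^ 2"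
        unfolding q_modulus_def using q1 qq
        by (subst diff_conv_add_uminus, subst degree_add_eq_left) (auto simp: degree_monom_eq)
      ultimately show ?thesis using qq by simp
    qed
    moreover have smult_pc: "smult ?c g = [:?c:] * g" for g :: "'a poly" by simp
    ultimately have "q_comp q 1 f ?\<phi> = ?r"
      unfolding q_comp_def smult_pc by (metis mod_mult_self1 mod_poly_less)
    moreover have "?c ^ q = ?c" using ab frob[of \<gamma>] by (simp add: power_mult_distrib flip: power_mult)
    ultimately show ?thesis unfolding D using ab(2) by (intro CollectI exI[of _ ?c] exI[of _ a]) simp
  qed
  then have "?\<phi> \<in> middle_nucleus q 1 (D_set q 1 1 s \<gamma>)"
    using qp by (simp add: middle_nucleus_def)
  moreover have "?\<phi> \<noteq> monom a 1" for a
    using \<gamma>0 q1 by (metis degree_monom_eq degree_monom_le not_le)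
  ultimately show ?thesis by blast
qed

end

theory Submission
  imports Defs "HOL-Number_Theory.Cong"
begin

text \<open>
  Write \<open>N = 2 n\<close>, \<open>F\<close> for the field with \<open>q\<^sup>N\<close> elements, \<open>K\<close> for its subfield with
  \<open>q\<^sup>n\<close> elements, and \<open>\<sigma>\<close> for the map \<open>x \<mapsto> x^(q^s)\<close>. As \<open>s\<close> is prime to \<open>N\<close>, the powers
  \<open>\<sigma>\<^sup>t\<close> with \<open>0 \<le> t < N\<close> run through all powers of the Frobenius map, so a reduced \<open>q\<close>-polynomial
  is the same as a twisted polynomial \<open>\<Sum> d\<^sub>t \<sigma>\<^sup>t\<close> with indices read modulo \<open>N\<close>, and composition
  becomes the twisted product \<open>u \<sigma>\<^sup>i \<circ> v \<sigma>\<^sup>j = u \<sigma>\<^sup>i(v) \<sigma>\<^sup>i\<^sup>+\<^sup>j\<close>. In these coordinates \<open>D\<close> is cut out by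
  conditions on single coefficients (lemma \<open>in_D_iff\<close>): the one at \<open>0\<close> lies in \<open>K\<close>, the one at \<open>k\<close>
  lies in \<open>\<gamma> K\<close>, and those strictly between \<open>k\<close> and \<open>N\<close> vanish; at \<open>1, \<dots>, k - 1\<close> nothing is
  imposed. Maps \<open>a X\<close> with \<open>a \<in> K\<close> rescale every coefficient by an element of \<open>K\<close>, so they lie in
  both nuclei.

  Conversely let \<open>\<phi> = \<Sum> d\<^sub>t \<sigma>\<^sup>t\<close> belong to one of the nuclei. Composing with \<open>X \<in> D\<close> gives
  \<open>\<phi> \<in> D\<close>, so only \<open>d\<^sub>t = 0\<close> for \<open>0 < t < N\<close> is missing.

  If \<open>k \<ge> 2\<close>, compose with \<open>c \<sigma>\<^sup>i\<close> for \<open>1 \<le> i < k\<close>. The coefficient of the product at \<open>m\<close> is, up to a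
  field automorphism, a multiple of \<open>d\<^sub>m\<^sub>-\<^sub>i\<close>, and it takes every value in \<open>F\<close> as \<open>c\<close> varies unless
  \<open>d\<^sub>m\<^sub>-\<^sub>i = 0\<close>. For \<open>k \<le> m \<le> N\<close> the code only admits the proper subsets \<open>\<gamma> K\<close>, \<open>0\<close> or \<open>K\<close> of
  \<open>F\<close> at \<open>m\<close>, where \<open>m = N\<close> stands for index \<open>0\<close> (lemma \<open>D_tail_absorbing\<close>). Hence \<open>d\<^sub>m\<^sub>-\<^sub>i = 0\<close>,
  and the differences \<open>m - i\<close> exhaust \<open>1, \<dots>, N - 1\<close> (lemma \<open>scalar_if_window_vanish\<close>).

  If \<open>k = 1\<close> there is no such \<open>i\<close>, and \<open>\<phi> = d\<^sub>0 + d\<^sub>1 \<sigma>\<close>. Composing with \<open>\<gamma> \<sigma>\<close> produces at index \<open>2\<close> a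
  coefficient that vanishes only if \<open>d\<^sub>1 = 0\<close>, as \<open>\<gamma> \<noteq> 0\<close>; and it must vanish because \<open>1 < 2 < N\<close>, which
  is where \<open>n \<ge> 2\<close> enters. That \<open>\<gamma> \<noteq> 0\<close> follows from its norm being a non-square, \<open>0\<close> being a square.
\<close>

section \<open>Polynomial identities\<close>

lemma sum_mod_poly: "sum f A mod (g :: 'a::field poly) = (\<Sum>x\<in>A. f x mod g)"
  by (induction A rule: infinite_finite_induct) (simp_all add: poly_mod_add_left)

lemma smult_sum_right: "smult u (sum f A) = (\<Sum>x\<in>A. smult u (f x))" for u :: "'a::comm_semiring_0"
  by (induction A rule: infinite_finite_induct) (simp_all add: smult_add_right)

lemma pcompose_monom_left: "pcompose (monom u e) g = smult u (g ^ e)" for u :: "'a::comm_semiring_1"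
proof -
  have "pcompose (monom 1 e) g = g ^ e"
    by (induction e) (simp_all add: monom_Suc pcompose_pCons pcompose_1)
  then show ?thesis by (metis mult.right_neutral pcompose_smult smult_monom)
qed

section \<open>Twisted polynomials over a finite field\<close>

text \<open>
  The index is an integer read modulo \<open>2 n\<close>, so that shifting indices needs no case distinction.
\<close>
definition q_coeff :: "nat \<Rightarrow> nat \<Rightarrow> 'a::finite_field poly \<Rightarrow> int \<Rightarrow> 'a" where
  "q_coeff q n f j = coeff f (q ^ nat (j mod int (2 * n)))"

definition frob :: "nat \<Rightarrow> nat \<Rightarrow> int \<Rightarrow> 'a::finite_field \<Rightarrow> 'a" where
  "frob q n j x = x ^ (q ^ nat (j mod int (2 * n)))"

locale q_polynomials =
  fixes q n :: nat and field_type :: "'a::finite_field itself"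
  assumes primepow_q: "primepow q"
    and n_pos: "0 < n"
    and card_field: "card (UNIV :: 'a set) = q ^ (2 * n)"
begin

lemma q_gt_1: "1 < q"
  using primepow_gt_Suc_0[OF primepow_q] by simp

text \<open>
  The characteristic divides the order of the field, since the translation \<open>x \<mapsto> x + 1\<close> permutes
  the field and so leaves the sum of all elements unchanged. That order is a power of the
  prime below \<open>q\<close>.
\<close>
lemma q_eq_CHAR_power: "\<exists>r. q = CHAR('a) ^ r"
proof -
  obtain p r where p: "prime p" "q = p ^ r"
    using primepow_q by (auto simp: primepow_def)
  have "(\<Sum>x\<in>UNIV. x + 1) = (\<Sum>x\<in>UNIV. x :: 'a)"
    by (rule sum.reindex_bij_witness[of _ "\<lambda>x. x - 1" "\<lambda>x. x + 1"]) auto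
  then have "of_nat (card (UNIV :: 'a set)) = (0 :: 'a)" by (simp add: sum.distrib)
  then have "CHAR('a) dvd p ^ (r * (2 * n))"
    unfolding card_field p(2) of_nat_eq_0_iff_char_dvd by (simp only: power_mult)
  then have "CHAR('a) dvd p"
    using CHAR_prime prime_dvd_power by blast
  then have "CHAR('a) = p"
    using CHAR_prime p(1) primes_dvd_imp_eq by blast
  with p(2) show ?thesis by blast
qed

lemma frobenius_power_sum_poly:
  fixes f :: "'b \<Rightarrow> 'a poly"
  shows "sum f A ^ (q ^ e) = (\<Sum>x\<in>A. f x ^ (q ^ e))"
proof -
  obtain r where "q = CHAR('a) ^ r" using q_eq_CHAR_power by blast
  then have "q ^ e = CHAR('a poly) ^ (r * e)" by (simp add: power_mult)
  moreover have "prime CHAR('a poly)" by simp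
  ultimately show ?thesis by (intro freshmans_dream_sum')
qed

lemma degree_q_modulus: "degree (q_modulus q n :: 'a poly) = q ^ (2 * n)"
proof -
  have "1 < q ^ (2 * n)" using q_gt_1 n_pos by (intro one_less_power) auto
  then show ?thesis
    unfolding q_modulus_def
    by (subst diff_conv_add_uminus, subst degree_add_eq_left) (auto simp: degree_monom_eq)
qed

text \<open>
  This is what makes exponents periodic: raise \<open>X^(q^(2 n)) = M + X\<close>, with \<open>M\<close> the modulus, to the
  power \<open>q^m\<close>, which is additive.
\<close>
lemma monom_mod_q_modulus:
  "monom u (q ^ (2 * n + m)) mod q_modulus q n = monom u (q ^ m) mod q_modulus q n" for u :: 'a
proof -
  let ?M = "q_modulus q n :: 'a poly"
  \<comment> \<open>A two-element index set turns the additivity of the power for sums into that for \<open>M + X\<close>.\<close>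
  let ?f = "\<lambda>b. if b then ?M else monom 1 1"
  have "(?M + monom 1 1) ^ (q ^ m) = ?M ^ (q ^ m) + monom 1 1 ^ (q ^ m)"
    using frobenius_power_sum_poly[of ?f UNIV m] by (simp add: UNIV_bool add.commute)
  then have "monom 1 (q ^ (2 * n + m)) = ?M ^ (q ^ m) + monom 1 (q ^ m)"
    by (simp add: q_modulus_def monom_power power_add)
  then have "monom u (q ^ (2 * n + m)) = smult u (?M ^ (q ^ m)) + monom u (q ^ m)"
    by (metis mult.right_neutral smult_add_right smult_monom)
  moreover have "?M dvd ?M ^ (q ^ m)" using q_gt_1 by (intro dvd_power) auto
  then have "smult u (?M ^ (q ^ m)) mod ?M = 0"
    by (intro dvd_imp_mod_0 dvd_smult)
  ultimately show ?thesis by (simp add: poly_mod_add_left)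
qed

lemma q_monom_0: "q_monom q n u 0 = monom u 1"
  by (simp add: q_monom_def)

text \<open>
  The commutation rule of the twisted polynomial ring. The sum of the two reduced exponents is below
  \<open>4 n\<close>, so one use of the periodicity brings it back into range.
\<close>
lemma q_comp_q_monom_q_monom:
  "q_comp q n (q_monom q n u i) (q_monom q n v j) = q_monom q n (u * frob q n i v) (i + j)"
  for u v :: 'a
proof -
  let ?N = "int (2 * n)"
  define a where "a = nat (i mod ?N)"
  define b where "b = nat (j mod ?N)"
  have ab: "i mod ?N = int a" "j mod ?N = int b" "a < 2 * n" "b < 2 * n"
    unfolding a_def b_def using n_pos by (simp_all add: nat_less_iff)
  have sum: "(i + j) mod ?N = int (a + b) mod ?N"
    using ab by (metis mod_add_eq of_nat_add)
  have low: "monom w (q ^ m) mod q_modulus q n = monom w (q ^ m)" if "m < 2 * n" for m and w :: 'a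
    using that q_gt_1 degree_q_modulus
    by (intro mod_poly_less order.strict_trans1[OF degree_monom_le]) simp
  have "q_comp q n (q_monom q n u i) (q_monom q n v j)
      = monom (u * v ^ (q ^ a)) (q ^ (a + b)) mod q_modulus q n"
    unfolding q_comp_def q_monom_def a_def[symmetric] b_def[symmetric]
    by (simp add: pcompose_monom_left monom_power smult_monom power_add mult.commute)
  also have "\<dots> = monom (u * v ^ (q ^ a)) (q ^ nat ((i + j) mod ?N))"
  proof (cases "a + b < 2 * n")
    case True
    then have "nat ((i + j) mod ?N) = a + b" unfolding sum by (simp flip: of_nat_mod)
    with True show ?thesis by (simp add: low)
  next
    case False
    then obtain m where m: "a + b = 2 * n + m" using le_Suc_ex not_less by blast
    then have m_less: "m < 2 * n" using ab by linarith
    then have "nat ((i + j) mod ?N) = m" unfolding sum m by (simp flip: of_nat_mod)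
    with m_less show ?thesis unfolding m monom_mod_q_modulus by (simp add: low)
  qed
  finally show ?thesis by (simp add: q_monom_def frob_def a_def)
qed

lemma q_coeff_q_monom:
  "q_coeff q n (q_monom q n u i) j = (if i mod int (2 * n) = j mod int (2 * n) then u else 0)"
  using q_gt_1 n_pos by (simp add: q_coeff_def q_monom_def eq_nat_nat_iff)

lemma q_coeff_add: "q_coeff q n (f + g) j = q_coeff q n f j + q_coeff q n g j"
  by (simp add: q_coeff_def)

lemma q_coeff_sum: "q_coeff q n (sum f A) j = (\<Sum>x\<in>A. q_coeff q n (f x) j)"
  by (simp add: q_coeff_def coeff_sum)

lemma q_coeff_mod: "q_coeff q n f (j mod int (2 * n)) = q_coeff q n f j"
  by (simp add: q_coeff_def)

lemma q_polys_eq_sum_q_coeff: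
  assumes "(f :: 'a poly) \<in> q_polys q n"
  shows "f = (\<Sum>i<2 * n. q_monom q n (q_coeff q n f (int i)) (int i))"
proof -
  obtain c where c: "f = (\<Sum>i<2 * n. monom (c i) (q ^ i))"
    using assms unfolding q_polys_def by blast
  also have "\<dots> = (\<Sum>i<2 * n. q_monom q n (c i) (int i))"
    by (intro sum.cong) (auto simp: q_monom_def simp flip: of_nat_mod)
  finally have f: "f = (\<Sum>i<2 * n. q_monom q n (c i) (int i))" .
  have "q_coeff q n f (int i) = c i" if "i < 2 * n" for i
  proof -
    have "(int l mod int (2 * n) = int i mod int (2 * n)) = (l = i)" if "l < 2 * n" for l
      using that \<open>i < 2 * n\<close> by (simp flip: of_nat_mod)
    then have "q_coeff q n f (int i) = (\<Sum>l<2 * n. if l = i then c l else 0)"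
      unfolding f by (simp add: q_coeff_sum q_coeff_q_monom)
    with that show ?thesis by simp
  qed
  with f show ?thesis by (metis (no_types, lifting) lessThan_iff sum.cong)
qed

lemma q_poly_eqI:
  assumes "(f :: 'a poly) \<in> q_polys q n" "g \<in> q_polys q n"
    and "\<And>j. q_coeff q n f j = q_coeff q n g j"
  shows "f = g"
  using assms q_polys_eq_sum_q_coeff[of f] q_polys_eq_sum_q_coeff[of g] by simp

lemma add_in_q_polys:
  assumes "(f :: 'a poly) \<in> q_polys q n" "g \<in> q_polys q n"
  shows "f + g \<in> q_polys q n"
proof -
  obtain c d where "f = (\<Sum>i<2 * n. monom (c i) (q ^ i))" "g = (\<Sum>i<2 * n. monom (d i) (q ^ i))"
    using assms unfolding q_polys_def by blast
  then have "f + g = (\<Sum>i<2 * n. monom (c i + d i) (q ^ i))"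
    by (simp add: sum.distrib flip: add_monom)
  then show ?thesis unfolding q_polys_def by (intro CollectI exI conjI TrueI)
qed

lemma q_monom_in_q_polys: "q_monom q n (u :: 'a) i \<in> q_polys q n"
proof -
  define e where "e = nat (i mod int (2 * n))"
  have "e < 2 * n" unfolding e_def using n_pos by (simp add: nat_less_iff)
  then have "q_monom q n u i = (\<Sum>l<2 * n. if l = e then monom u (q ^ l) else 0)"
    by (simp add: q_monom_def e_def)
  also have "\<dots> = (\<Sum>l<2 * n. monom (if l = e then u else 0) (q ^ l))"
    by (intro sum.cong) auto
  finally show ?thesis unfolding q_polys_def by (intro CollectI exI conjI TrueI)
qed

lemma sum_in_q_polys:
  assumes "\<And>x. x \<in> A \<Longrightarrow> (f x :: 'a poly) \<in> q_polys q n"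
  shows "sum f A \<in> q_polys q n"
proof -
  have "(0 :: 'a poly) \<in> q_polys q n"
    using q_monom_in_q_polys[of 0 0] by (simp add: q_monom_def)
  with assms show ?thesis
    by (induction A rule: infinite_finite_induct) (simp_all add: add_in_q_polys)
qed

lemma q_comp_q_monom_left:
  assumes "(f :: 'a poly) \<in> q_polys q n"
  shows "q_comp q n (q_monom q n u i) f
    = (\<Sum>l<2 * n. q_monom q n (u * frob q n i (q_coeff q n f (int l))) (i + int l))"
proof -
  let ?g = "\<lambda>l. q_monom q n (q_coeff q n f (int l)) (int l)"
  have "q_comp q n (q_monom q n u i) (sum ?g {..<2 * n})
      = (\<Sum>l<2 * n. q_comp q n (q_monom q n u i) (?g l))"
    unfolding q_comp_def q_monom_def[of q n u] pcompose_monom_left frobenius_power_sum_poly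
      smult_sum_right sum_mod_poly ..
  then show ?thesis
    unfolding q_polys_eq_sum_q_coeff[OF assms, symmetric] q_comp_q_monom_q_monom .
qed

lemma q_comp_q_monom_right:
  assumes "(f :: 'a poly) \<in> q_polys q n"
  shows "q_comp q n f (q_monom q n u i)
    = (\<Sum>l<2 * n. q_monom q n (q_coeff q n f (int l) * frob q n (int l) u) (int l + i))"
proof -
  let ?g = "\<lambda>l. q_monom q n (q_coeff q n f (int l)) (int l)"
  have "q_comp q n (sum ?g {..<2 * n}) (q_monom q n u i)
      = (\<Sum>l<2 * n. q_comp q n (?g l) (q_monom q n u i))"
    unfolding q_comp_def pcompose_sum sum_mod_poly ..
  then show ?thesis
    unfolding q_polys_eq_sum_q_coeff[OF assms, symmetric] q_comp_q_monom_q_monom .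
qed

lemma q_coeff_sum_q_monom_shift:
  "q_coeff q n (\<Sum>l<2 * n. q_monom q n (c (int l)) (int l + i)) j = c ((j - i) mod int (2 * n))"
  for c :: "int \<Rightarrow> 'a"
proof -
  let ?N = "int (2 * n)"
  define e where "e = nat ((j - i) mod ?N)"
  have e: "(j - i) mod ?N = int e" "e < 2 * n"
    unfolding e_def using n_pos by (simp_all add: nat_less_iff)
  have "((int l + i) mod ?N = j mod ?N) = (l = e)" if "l < 2 * n" for l
  proof -
    have "(int l + i) mod ?N = j mod ?N \<longleftrightarrow> int l mod ?N = (j - i) mod ?N"
      by (simp add: mod_eq_dvd_iff algebra_simps)
    also have "\<dots> \<longleftrightarrow> l = e" unfolding e using that by (simp flip: of_nat_mod)
    finally show ?thesis .
  qed
  then have "q_coeff q n (\<Sum>l<2 * n. q_monom q n (c (int l)) (int l + i)) j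
      = (\<Sum>l<2 * n. if l = e then c (int l) else 0)"
    by (simp add: q_coeff_sum q_coeff_q_monom)
  with e show ?thesis by simp
qed

lemma frob_mod: "frob q n (j mod int (2 * n)) x = frob q n j x"
  by (simp add: frob_def)

text \<open>
  Composing with a monomial shifts the coefficients and twists them, so each coefficient of the
  product sees a single coefficient of the other factor.
\<close>
lemma q_coeff_q_comp_left:
  assumes "(f :: 'a poly) \<in> q_polys q n"
  shows "q_coeff q n (q_comp q n (q_monom q n u i) f) j = u * frob q n i (q_coeff q n f (j - i))"
  unfolding q_comp_q_monom_left[OF assms] add.commute[of i]
  by (subst q_coeff_sum_q_monom_shift[where c = "\<lambda>l. u * frob q n i (q_coeff q n f l)"])
    (simp only: q_coeff_mod)

lemma q_coeff_q_comp_right: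
  assumes "(f :: 'a poly) \<in> q_polys q n"
  shows "q_coeff q n (q_comp q n f (q_monom q n u i)) j = q_coeff q n f (j - i) * frob q n (j - i) u"
  unfolding q_comp_q_monom_right[OF assms]
  by (subst q_coeff_sum_q_monom_shift[where c = "\<lambda>l. q_coeff q n f l * frob q n l u"])
    (simp only: q_coeff_mod frob_mod)

lemma q_comp_q_monom_in_q_polys:
  assumes "(f :: 'a poly) \<in> q_polys q n"
  shows "q_comp q n (q_monom q n u i) f \<in> q_polys q n"
    and "q_comp q n f (q_monom q n u i) \<in> q_polys q n"
  using assms
  by (simp_all add: q_comp_q_monom_left q_comp_q_monom_right sum_in_q_polys q_monom_in_q_polys)

lemma frob_eq_0_iff: "frob q n j x = 0 \<longleftrightarrow> (x :: 'a) = 0"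
  using q_gt_1 by (simp add: frob_def)

text \<open>
  Surjectivity with an explicit preimage: the reduced exponents of \<open>j\<close> and \<open>- j\<close> add up to \<open>0\<close> or
  \<open>2 n\<close>, and the \<open>2 n\<close>-th power of the Frobenius map is the identity.
\<close>
lemma frob_frob_minus: "frob q n j (frob q n (- j) x) = (x :: 'a)"
proof -
  let ?N = "int (2 * n)"
  have "(j mod ?N + - j mod ?N) mod ?N = 0" by (simp add: mod_add_eq)
  then have "?N dvd j mod ?N + - j mod ?N" by presburger
  moreover have "0 \<le> j mod ?N" "0 \<le> - j mod ?N" using n_pos by simp_all
  ultimately have "?N dvd int (nat (- j mod ?N) + nat (j mod ?N))"
    by (simp only: of_nat_add int_nat_eq if_True add.commute)
  then have "2 * n dvd nat (- j mod ?N) + nat (j mod ?N)"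
    unfolding int_dvd_int_iff .
  then obtain r where r: "nat (- j mod ?N) + nat (j mod ?N) = 2 * n * r" by blast
  have "frob q n j (frob q n (- j) x) = x ^ (q ^ (2 * n * r))"
    unfolding frob_def r[symmetric] by (simp add: power_add flip: power_mult)
  also have "\<dots> = x"
    using finite_field_power_card_power_eq_same[of _ r x] card_field by (simp add: power_mult)
  finally show ?thesis .
qed

lemma mult_in_subfield:
  assumes "a \<in> subfield_of_order q n" "b \<in> subfield_of_order q n"
  shows "(a * b :: 'a) \<in> subfield_of_order q n"
  using assms by (simp add: subfield_of_order_def power_mult_distrib)

lemma zero_in_subfield: "(0 :: 'a) \<in> subfield_of_order q n"
  and one_in_subfield: "(1 :: 'a) \<in> subfield_of_order q n"
  using q_gt_1 by (simp_all add: subfield_of_order_def)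

lemma frob_in_subfield:
  assumes "(a :: 'a) \<in> subfield_of_order q n"
  shows "frob q n j a \<in> subfield_of_order q n"
  using assms by (simp add: subfield_of_order_def frob_def power_commutes flip: power_mult)
    (metis mult.commute power_mult)

lemma subfield_proper: "\<exists>z :: 'a. z \<notin> subfield_of_order q n"
proof -
  have "card (subfield_of_order q n :: 'a set) = q ^ n"
    using card_field n_pos q_gt_1 by (intro card_subfield_of_order) auto
  moreover have "q ^ n < q ^ (2 * n)" using q_gt_1 n_pos by simp
  ultimately have "(subfield_of_order q n :: 'a set) \<noteq> UNIV" using card_field by auto
  then show ?thesis by blast
qed

end

section \<open>The code in twisted coordinates\<close>

locale D_code = q_polynomials q n "TYPE('a::finite_field)" for q n +
  fixes k :: nat and s :: int and \<gamma> :: "'a::finite_field"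
  assumes coprime_s: "coprime s (int (2 * n))"
    and \<gamma>_nonzero: "\<gamma> \<noteq> 0"
    and n_gt_1: "1 < n"
    and k_bounds: "1 \<le> k" "k < 2 * n"
begin

abbreviation K :: "'a set" where "K \<equiv> subfield_of_order q n"
abbreviation D :: "'a poly set" where "D \<equiv> D_set q n k s \<gamma>"

lemma mult_s_cong_iff:
  "i * s mod int (2 * n) = j * s mod int (2 * n) \<longleftrightarrow> i mod int (2 * n) = j mod int (2 * n)"
proof -
  have "int (2 * n) dvd (i - j) * s \<longleftrightarrow> int (2 * n) dvd i - j"
    using coprime_s by (simp add: coprime_commute coprime_dvd_mult_left_iff)
  then show ?thesis by (simp add: mod_eq_dvd_iff left_diff_distrib)
qed

lemma obtain_twisted_index:
  obtains t where "0 \<le> t" "t < int (2 * n)" "j mod int (2 * n) = t * s mod int (2 * n)"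
proof -
  let ?N = "int (2 * n)"
  obtain r where "[s * r = 1] (mod ?N)" using coprime_s cong_solve_coprime_int by blast
  then have "[j * (s * r) = j * 1] (mod ?N)" by (intro cong_mult cong_refl)
  then have "j mod ?N = (j * r) * s mod ?N" by (simp add: cong_def mult_ac)
  also have "\<dots> = ((j * r) mod ?N) * s mod ?N" by (simp add: mod_mult_left_eq)
  finally show ?thesis using n_pos by (intro that[of "j * r mod ?N"]) auto
qed

lemma q_poly_eqI_twisted:
  assumes "(f :: 'a poly) \<in> q_polys q n" "g \<in> q_polys q n"
    and "\<And>t. 0 \<le> t \<Longrightarrow> t < int (2 * n) \<Longrightarrow> q_coeff q n f (t * s) = q_coeff q n g (t * s)"
  shows "f = g"
  using assms(1,2)
proof (rule q_poly_eqI)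
  show "q_coeff q n f j = q_coeff q n g j" for j
    using assms(3) obtain_twisted_index[of j] q_coeff_mod by metis
qed

text \<open>
  The exponents occurring in an element of the code are pairwise distinct modulo \<open>2 n\<close>, so its
  parameters can be read off as coefficients.
\<close>
lemma q_coeff_D_shape:
  assumes "0 \<le> m" "m < int (2 * n)"
  shows "q_coeff q n (q_monom q n a 0 + (\<Sum>i=1..k-1. q_monom q n (c i) (int i * s))
      + q_monom q n b (int k * s)) (m * s)
    = (if m = 0 then a else if m < int k then c (nat m) else if m = int k then b else 0)"
proof -
  let ?N = "int (2 * n)"
  have cong: "(int i * s mod ?N = m * s mod ?N) = (int i = m)" if "i < 2 * n" for i
    unfolding mult_s_cong_iff using that assms by (simp add: mod_pos_pos_trivial)
  have "(0 = m * s mod ?N) = (0 = m)"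
    using cong[of 0] n_pos by simp
  moreover have "(\<Sum>i=1..k-1. q_coeff q n (q_monom q n (c i) (int i * s)) (m * s))
      = (\<Sum>i=1..k-1. if i = nat m then c i else 0)"
  proof (rule sum.cong)
    fix i assume "i \<in> {1..k-1}"
    then have "i < 2 * n" using k_bounds by auto
    then show "q_coeff q n (q_monom q n (c i) (int i * s)) (m * s) = (if i = nat m then c i else 0)"
      unfolding q_coeff_q_monom cong[OF \<open>i < 2 * n\<close>] using assms(1) by auto
  qed simp
  moreover have "(int k * s mod ?N = m * s mod ?N) = (int k = m)"
    using cong k_bounds by simp
  ultimately show ?thesis
    using assms k_bounds by (auto simp: q_coeff_add q_coeff_sum q_coeff_q_monom)
qed

lemma in_D_iff:
  "f \<in> D \<longleftrightarrow> f \<in> q_polys q n \<and> q_coeff q n f 0 \<in> K \<and> q_coeff q n f (int k * s) \<in> (*) \<gamma> ` K \<and>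
    (\<forall>m. int k < m \<and> m < int (2 * n) \<longrightarrow> q_coeff q n f (m * s) = 0)"
  (is "_ \<longleftrightarrow> ?R")
proof -
  let ?f = "\<lambda>a b c. q_monom q n (a :: 'a) 0 + (\<Sum>i=1..k-1. q_monom q n (c i) (int i * s))
      + q_monom q n b (int k * s)"
  have poly: "?f a b c \<in> q_polys q n" for a b c
    by (intro add_in_q_polys sum_in_q_polys q_monom_in_q_polys)
  show ?thesis
  proof
    assume "f \<in> D"
    then obtain a b c where f: "f = ?f a (\<gamma> * b) c" "a \<in> K" "b \<in> K"
      unfolding D_set_def by blast
    note coeffs = q_coeff_D_shape[of _ a c "\<gamma> * b", folded f(1)]
    have "q_coeff q n f 0 = a" using coeffs[of 0] n_pos by simp
    moreover have "q_coeff q n f (int k * s) = \<gamma> * b" using coeffs[of "int k"] k_bounds by simp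
    moreover have "q_coeff q n f (m * s) = 0" if "int k < m" "m < int (2 * n)" for m
      using coeffs[of m] that by simp
    moreover have "f \<in> q_polys q n" unfolding f(1) by (rule poly)
    ultimately show ?R using f(2,3) by auto
  next
    assume R: ?R
    then obtain b where b: "b \<in> K" "q_coeff q n f (int k * s) = \<gamma> * b" by blast
    let ?c = "\<lambda>i. q_coeff q n f (int i * s)"
    have eq: "f = ?f (q_coeff q n f 0) (\<gamma> * b) ?c"
    proof (rule q_poly_eqI_twisted[OF _ poly])
      show "f \<in> q_polys q n" using R by blast
      fix m assume m: "0 \<le> m" "m < int (2 * n)"
      show "q_coeff q n f (m * s) = q_coeff q n (?f (q_coeff q n f 0) (\<gamma> * b) ?c) (m * s)"
        unfolding q_coeff_D_shape[OF m] using m R b by auto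
    qed
    have "q_coeff q n f 0 \<in> K" using R by blast
    then show "f \<in> D"
      unfolding D_set_def using b(1) by (intro CollectI exI conjI) (rule eq)
  qed
qed

lemma q_monom_0_in_D: "a \<in> K \<Longrightarrow> q_monom q n a 0 \<in> D"
  and q_monom_middle_in_D: "1 \<le> i \<Longrightarrow> i < int k \<Longrightarrow> q_monom q n u (i * s) \<in> D"
  and q_monom_last_in_D: "a \<in> K \<Longrightarrow> q_monom q n (\<gamma> * a) (int k * s) \<in> D"
proof -
  have neq: "i * s mod int (2 * n) \<noteq> j * s mod int (2 * n)"
    if "0 \<le> i" "i < int (2 * n)" "0 \<le> j" "j < int (2 * n)" "i \<noteq> j" for i j
    unfolding mult_s_cong_iff using that by (simp add: mod_pos_pos_trivial)
  have neq0: "j * s mod int (2 * n) \<noteq> 0" if "0 < j" "j < int (2 * n)" for j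
    using neq[of j 0] that by simp
  have zero: "0 \<in> (*) \<gamma> ` K" using zero_in_subfield by force
  show "q_monom q n a 0 \<in> D" if "a \<in> K"
    unfolding in_D_iff using that zero zero_in_subfield k_bounds neq0
    by (auto simp: q_monom_in_q_polys q_coeff_q_monom)
  show "q_monom q n u (i * s) \<in> D" if "1 \<le> i" "i < int k"
    unfolding in_D_iff using that zero zero_in_subfield k_bounds neq0[of i] neq[of i]
    by (auto simp: q_monom_in_q_polys q_coeff_q_monom)
  show "q_monom q n (\<gamma> * a) (int k * s) \<in> D" if "a \<in> K"
    unfolding in_D_iff using that zero_in_subfield k_bounds neq0[of k] neq[of k]
    by (auto simp: q_monom_in_q_polys q_coeff_q_monom)
qed

text \<open>
  At each index \<open>m\<close> from \<open>k\<close> up to \<open>2 n\<close>, the last one denoting index \<open>0\<close>, the coefficients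
  of codewords stay inside \<open>\<gamma> K\<close>, \<open>0\<close> or \<open>K\<close>. The multiples of a nonzero \<open>y\<close> fill the whole field,
  which is strictly larger.
\<close>
lemma D_tail_absorbing:
  assumes m: "int k \<le> m" "m \<le> int (2 * n)"
    and ex: "\<And>u. \<exists>f\<in>D. q_coeff q n f (m * s) = u * y"
  shows "y = 0"
proof (rule ccontr)
  assume y: "y \<noteq> 0"
  then have all: "\<exists>f\<in>D. q_coeff q n f (m * s) = v" for v
    using ex[of "v / y"] by simp
  obtain z where z: "z \<notin> K" using subfield_proper by blast
  consider "m = int k" | "m = int (2 * n)" | "int k < m" "m < int (2 * n)"
    using m by linarith
  then show False
  proof cases
    case 1
    with all[of "\<gamma> * z"] have "\<gamma> * z \<in> (*) \<gamma> ` K" by (auto simp: in_D_iff)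
    with z \<gamma>_nonzero show False by auto
  next
    case 2
    then have "q_coeff q n f (m * s) = q_coeff q n f 0" for f :: "'a poly"
      by (simp add: q_coeff_def)
    with all[of z] z show False by (auto simp: in_D_iff)
  next
    case 3
    with all[of 1] show False by (auto simp: in_D_iff)
  qed
qed

lemma scalar_if_coeffs_vanish:
  assumes "f \<in> D" and "\<And>t. 1 \<le> t \<Longrightarrow> t < int (2 * n) \<Longrightarrow> q_coeff q n f (t * s) = 0"
  shows "f \<in> {monom a 1 | a. a \<in> K}"
proof -
  have a: "q_coeff q n f 0 \<in> K" "f \<in> q_polys q n" using assms(1) by (auto simp: in_D_iff)
  have "f = q_monom q n (q_coeff q n f 0) 0"
    using a(2) q_monom_in_q_polys
  proof (rule q_poly_eqI_twisted)
    fix t assume t: "0 \<le> t" "t < int (2 * n)"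
    have "0 mod int (2 * n) \<noteq> t * s mod int (2 * n)" if "t \<noteq> 0"
      using mult_s_cong_iff[of 0 t] t that by simp
    then show "q_coeff q n f (t * s) = q_coeff q n (q_monom q n (q_coeff q n f 0) 0) (t * s)"
      using t assms(2)[of t] by (cases "t = 0") (auto simp: q_coeff_q_monom)
  qed
  with a(1) show ?thesis unfolding q_monom_0 by blast
qed

text \<open>
  The windows \<open>k - i, \<dots>, 2 n - i\<close> for \<open>1 \<le> i < k\<close> cover \<open>1, \<dots>, 2 n - 1\<close> as soon as \<open>k \<ge> 2\<close>: small
  indices are reached from \<open>i = k - 1\<close>, and the others as right ends \<open>m = 2 n\<close>. There is no
  window for \<open>k = 1\<close>, but then membership in the code leaves only the coefficient at index \<open>1\<close>.
\<close>
lemma scalar_if_window_vanish: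
  assumes f: "f \<in> D"
    and one: "k = 1 \<Longrightarrow> q_coeff q n f s = 0"
    and window: "\<And>i m. 1 \<le> i \<Longrightarrow> i < int k \<Longrightarrow> int k \<le> m \<Longrightarrow> m \<le> int (2 * n) \<Longrightarrow>
      q_coeff q n f ((m - i) * s) = 0"
  shows "f \<in> {monom a 1 | a. a \<in> K}"
  using f
proof (rule scalar_if_coeffs_vanish)
  fix t assume t: "1 \<le> t" "t < int (2 * n)"
  consider "k = 1" "t = 1" | "k = 1" "1 < t" | "1 < k" "t \<le> int (2 * n) - int k + 1"
    | "1 < k" "t > int (2 * n) - int k + 1"
    using k_bounds t by linarith
  then show "q_coeff q n f (t * s) = 0"
  proof cases
    case 1
    with one show ?thesis by simp
  next
    case 2
    with f t show ?thesis unfolding in_D_iff by auto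
  next
    case 3
    with window[of "int k - 1" "t + (int k - 1)"] t show ?thesis by simp
  next
    case 4
    with window[of "int (2 * n) - t" "int (2 * n)"] t k_bounds show ?thesis by simp
  qed
qed

section \<open>The two nuclei\<close>

text \<open>
  On the right a factor \<open>c \<sigma>\<^sup>i\<close> contributes a conjugate \<open>\<sigma>\<^sup>j(c)\<close> to each coefficient. To obtain
  all multiples of \<open>d\<^sub>j\<close> at a chosen index one takes \<open>c\<close> to be the \<open>\<sigma>\<^sup>j\<close>-preimage of the multiplier.
\<close>
lemma right_nucleus_D: "right_nucleus q n D = {monom a 1 | a. a \<in> K}"
proof (intro equalityI subsetI)
  fix \<phi> assume "\<phi> \<in> right_nucleus q n D"
  then have \<phi>: "\<phi> \<in> q_polys q n" and closed: "\<And>f. f \<in> D \<Longrightarrow> q_comp q n \<phi> f \<in> D"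
    by (auto simp: right_nucleus_def)
  note coeff = q_coeff_q_comp_right[OF \<phi>]
  have "\<phi> = q_comp q n \<phi> (q_monom q n 1 0)"
    using \<phi> q_comp_q_monom_in_q_polys(2)[OF \<phi>] by (rule q_poly_eqI) (simp add: coeff frob_def)
  then have "\<phi> \<in> D" using closed q_monom_0_in_D one_in_subfield by metis
  then show "\<phi> \<in> {monom a 1 | a. a \<in> K}"
  proof (rule scalar_if_window_vanish)
    assume k: "k = 1"
    then have "q_comp q n \<phi> (q_monom q n \<gamma> s) \<in> D"
      using closed q_monom_last_in_D[OF one_in_subfield] by simp
    then have "q_coeff q n (q_comp q n \<phi> (q_monom q n \<gamma> s)) (2 * s) = 0"
      using k n_gt_1 unfolding in_D_iff by force
    then show "q_coeff q n \<phi> s = 0" using \<gamma>_nonzero by (simp add: coeff frob_eq_0_iff)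
  next
    fix i m :: int
    assume im: "1 \<le> i" "i < int k" "int k \<le> m" "m \<le> int (2 * n)"
    show "q_coeff q n \<phi> ((m - i) * s) = 0"
    proof (rule D_tail_absorbing[OF im(3,4)])
      fix u :: 'a
      let ?j = "m * s - i * s"
      let ?f = "q_comp q n \<phi> (q_monom q n (frob q n (- ?j) u) (i * s))"
      have "?f \<in> D" using closed q_monom_middle_in_D im by blast
      moreover have "q_coeff q n ?f (m * s) = u * q_coeff q n \<phi> ((m - i) * s)"
        unfolding coeff frob_frob_minus left_diff_distrib by (rule mult.commute)
      ultimately show "\<exists>f\<in>D. q_coeff q n f (m * s) = u * q_coeff q n \<phi> ((m - i) * s)" by blast
    qed
  qed
next
  fix \<phi> assume "\<phi> \<in> {monom a 1 | a. a \<in> K}"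
  then obtain a where a: "a \<in> K" "\<phi> = q_monom q n a 0" unfolding q_monom_0 by blast
  have "q_comp q n \<phi> f \<in> D" if f: "f \<in> D" for f
  proof -
    have poly: "f \<in> q_polys q n" using f by (simp add: in_D_iff)
    have "q_coeff q n (q_comp q n \<phi> f) j = a * q_coeff q n f j" for j
      unfolding a(2) q_coeff_q_comp_left[OF poly] by (simp add: frob_def)
    moreover have "q_comp q n \<phi> f \<in> q_polys q n"
      unfolding a(2) using poly by (rule q_comp_q_monom_in_q_polys)
    ultimately show ?thesis
      using f a(1) mult_in_subfield by (auto simp: in_D_iff mult.left_commute)
  qed
  then show "\<phi> \<in> right_nucleus q n D"
    using a(2) q_monom_in_q_polys by (simp add: right_nucleus_def)
qed

text \<open>
  On the left the multiplier \<open>c\<close> appears untwisted and the coefficient of \<open>\<phi>\<close> is twisted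
  instead, which is harmless because the twist is injective. For the converse inclusion the
  scalar \<open>a\<close> meets each coefficient twisted, hence the stability of \<open>K\<close> under the Frobenius map.
\<close>
lemma middle_nucleus_D: "middle_nucleus q n D = {monom a 1 | a. a \<in> K}"
proof (intro equalityI subsetI)
  fix \<phi> assume "\<phi> \<in> middle_nucleus q n D"
  then have \<phi>: "\<phi> \<in> q_polys q n" and closed: "\<And>f. f \<in> D \<Longrightarrow> q_comp q n f \<phi> \<in> D"
    by (auto simp: middle_nucleus_def)
  note coeff = q_coeff_q_comp_left[OF \<phi>]
  have "\<phi> = q_comp q n (q_monom q n 1 0) \<phi>"
    using \<phi> q_comp_q_monom_in_q_polys(1)[OF \<phi>] by (rule q_poly_eqI) (simp add: coeff frob_def)
  then have "\<phi> \<in> D" using closed q_monom_0_in_D one_in_subfield by metis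
  then show "\<phi> \<in> {monom a 1 | a. a \<in> K}"
  proof (rule scalar_if_window_vanish)
    assume k: "k = 1"
    then have "q_comp q n (q_monom q n \<gamma> s) \<phi> \<in> D"
      using closed q_monom_last_in_D[OF one_in_subfield] by simp
    then have "q_coeff q n (q_comp q n (q_monom q n \<gamma> s) \<phi>) (2 * s) = 0"
      using k n_gt_1 unfolding in_D_iff by force
    then show "q_coeff q n \<phi> s = 0" using \<gamma>_nonzero by (simp add: coeff frob_eq_0_iff)
  next
    fix i m :: int
    assume im: "1 \<le> i" "i < int k" "int k \<le> m" "m \<le> int (2 * n)"
    have "frob q n (i * s) (q_coeff q n \<phi> ((m - i) * s)) = 0"
    proof (rule D_tail_absorbing[OF im(3,4)])
      fix u :: 'a
      have "q_comp q n (q_monom q n u (i * s)) \<phi> \<in> D"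
        using closed q_monom_middle_in_D im by blast
      then show "\<exists>f\<in>D. q_coeff q n f (m * s)
          = u * frob q n (i * s) (q_coeff q n \<phi> ((m - i) * s))"
        by (rule bexI[rotated]) (simp add: coeff left_diff_distrib)
    qed
    then show "q_coeff q n \<phi> ((m - i) * s) = 0" by (simp add: frob_eq_0_iff)
  qed
next
  fix \<phi> assume "\<phi> \<in> {monom a 1 | a. a \<in> K}"
  then obtain a where a: "a \<in> K" "\<phi> = q_monom q n a 0" unfolding q_monom_0 by blast
  have "q_comp q n f \<phi> \<in> D" if f: "f \<in> D" for f
  proof -
    have poly: "f \<in> q_polys q n" using f by (simp add: in_D_iff)
    have "q_coeff q n (q_comp q n f \<phi>) j = q_coeff q n f j * frob q n j a" for j
      unfolding a(2) q_coeff_q_comp_right[OF poly] by simp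
    moreover have "q_comp q n f \<phi> \<in> q_polys q n"
      unfolding a(2) using poly by (rule q_comp_q_monom_in_q_polys)
    ultimately show ?thesis
      using f frob_in_subfield[OF a(1)] mult_in_subfield by (auto simp: in_D_iff mult.assoc)
  qed
  then show "\<phi> \<in> middle_nucleus q n D"
    using a(2) q_monom_in_q_polys by (simp add: middle_nucleus_def)
qed

end

theorem theorem7:
  fixes q n k :: nat and s :: int and \<gamma> :: "'a::finite_field"
  assumes "primepow q"
    and "n > 0"
    and "n \<noteq> 1"
    and "card (UNIV :: 'a set) = q ^ (2 * n)"
    and "gcd s (int (2 * n)) = 1"
    and "\<not> is_square_in (subfield_of_order q 1) (norm_to_base q n \<gamma>)"
    and "1 \<le> k" and "k \<le> 2 * n - 1"
  shows "right_nucleus q n (D_set q n k s \<gamma>) = {monom a 1 | a. a \<in> subfield_of_order q n}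
       \<and> middle_nucleus q n (D_set q n k s \<gamma>) = {monom a 1 | a. a \<in> subfield_of_order q n}"
proof -
  have q: "1 < q" using primepow_gt_Suc_0[OF assms(1)] by simp
  have "\<gamma> \<noteq> 0"
  proof
    assume "\<gamma> = 0"
    then have "norm_to_base q n \<gamma> = 0 ^ 2"
      using q assms(2) by (auto simp: norm_to_base_def power_0_left)
    moreover have "(0 :: 'a) \<in> subfield_of_order q 1" using q by (simp add: subfield_of_order_def)
    ultimately show False using assms(6) unfolding is_square_in_def by blast
  qed
  then interpret D_code q n k s \<gamma>
    using assms by unfold_locales (auto simp: coprime_iff_gcd_eq_1)
  show ?thesis using right_nucleus_D middle_nucleus_D by blast
qed

end
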